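(* A general unweighted directed hypergraph $\left(1\pm\frac{1}{2^{O(\sqrt{\log n})}}\right)$ cut-sketching scheme on $n$ vertices with maximum sketch size of $k$ bits yields an $(n\cdot\ell,k,1/10,2^{-n})$ string compression scheme, for some $\ell=\frac{n^2}{2^{O(\sqrt{\log n})}}$.
   Context: For a directed hypergraph $G$ on vertex set $U$ with directed hyperedges $e=(L(e),R(e))$, $L(e),R(e)\subseteq U$, and $S\subseteq U$, $\mathrm{cut}_G(S)$ is the number of hyperedges with $L(e)\cap S\ne\emptyset$ and $R(e)\cap(U\setminus S)\ne\emptyset$. A $(1\pm\varepsilon)$ cut-sketching scheme maps each such hypergraph to a bit string from which, for every $S$, one can deterministically compute a value within a factor $(1\pm\varepsilon)$ of $\mathrm{cut}_G(S)$ using only the string and $S$. For positive integers $\ell,k$ and $\varepsilon,g>0$, a pair of functions $\mathrm{Encode}:\{0,1\}^\ell\to\{0,1\}^k$, $\mathrm{Decode}:\{0,1\}^k\times2^{[\ell]}\to\mathbb{N}$ is an $(\ell,k,\varepsilon,g)$ string compression scheme if there is a set $\mathcal G\subseteq\{0,1\}^\ell$ with $|\mathcal G|\ge g\cdot2^\ell$ such that for every $s\in\mathcal G$ and every $q\subseteq[\ell]$, $|\mathrm{Decode}(\mathrm{Encode}(s),q)-|s\cap q||\le\varepsilon\ell/2$, where $s$ is identified with the subset of $[\ell]$ of its $1$-positions. *)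

theory Defs
  imports Complex_Main "HOL-Library.Landau_Symbols"
begin

text \<open>
  A directed hyperedge is the pair \<open>(L(e), R(e))\<close>. Unweighted hypergraphs have no parallel
  hyperedges, so a hypergraph is given by its set of hyperedges. The two sides of a hyperedge may
  overlap, and may be empty.
\<close>

type_synonym 'v hyperedge = "'v set \<times> 'v set"

definition directed_hypergraph :: "'v set \<Rightarrow> 'v hyperedge set \<Rightarrow> bool" where
  "directed_hypergraph U H \<longleftrightarrow> (\<forall>(L, R) \<in> H. L \<subseteq> U \<and> R \<subseteq> U)"

definition cut :: "'v set \<Rightarrow> 'v hyperedge set \<Rightarrow> 'v set \<Rightarrow> nat" where
  "cut U H S = card {(L, R) \<in> H. L \<inter> S \<noteq> {} \<and> R \<inter> (U - S) \<noteq> {}}"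

text \<open>
  Sketches may have different lengths; \<open>k\<close> bounds all of them. The estimate is a function of the
  sketch and \<open>S\<close> alone; as it is fixed before the hypergraph, it may depend on \<open>U\<close>, but not on \<open>H\<close>.
\<close>

definition cut_sketching_scheme ::
  "'v set \<Rightarrow> real \<Rightarrow> nat \<Rightarrow> ('v hyperedge set \<Rightarrow> bool list) \<Rightarrow> (bool list \<Rightarrow> 'v set \<Rightarrow> real) \<Rightarrow> bool"
where
  "cut_sketching_scheme U \<epsilon> k sketch estimate \<longleftrightarrow>
     (\<forall>H. directed_hypergraph U H \<longrightarrow>
        length (sketch H) \<le> k \<and>
        (\<forall>S \<subseteq> U. (1 - \<epsilon>) * real (cut U H S) \<le> estimate (sketch H) S \<and>
                 estimate (sketch H) S \<le> (1 + \<epsilon>) * real (cut U H S)))"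

definition bitstrings :: "nat \<Rightarrow> bool list set" where
  "bitstrings m = {s. length s = m}"

text \<open>Positions of strings, and hence queries, are numbered from 0.\<close>

definition ones :: "bool list \<Rightarrow> nat set" where
  "ones s = {i. i < length s \<and> s ! i}"

definition string_compression_scheme ::
  "nat \<Rightarrow> nat \<Rightarrow> real \<Rightarrow> real \<Rightarrow> (bool list \<Rightarrow> bool list) \<Rightarrow> (bool list \<Rightarrow> nat set \<Rightarrow> nat) \<Rightarrow> bool"
where
  "string_compression_scheme l k \<epsilon> g Encode Decode \<longleftrightarrow>
     l > 0 \<and> k > 0 \<and> \<epsilon> > 0 \<and> g > 0 \<and>
     Encode ` bitstrings l \<subseteq> bitstrings k \<and>
     (\<exists>G \<subseteq> bitstrings l. real (card G) \<ge> g * 2 ^ l \<and>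
        (\<forall>s \<in> G. \<forall>q \<subseteq> {..<l}.
           \<bar>real (Decode (Encode s) q) - real (card (ones s \<inter> q))\<bar> \<le> \<epsilon> * real l / 2))"

end

theory Submission imports Defs "HOL-Library.FuncSet" begin

text \<open>
  Behrend's construction gives \<open>X \<subseteq> {..<N}\<close> of size \<open>N / 2 powr O(sqrt (log 2 N))\<close> without three-term
  progressions, hence a bipartite graph that is the union of \<open>N\<close> induced matchings of size \<open>card X\<close>.
  Use \<open>N\<close> copies of this graph, indexed by \<open>b\<close>, and let each bit of the string decide whether one
  edge \<open>(a, c)\<close> of one copy is kept. The hyperedge for \<open>(b, a)\<close> has tail \<open>{b}\<close>, and its head is \<open>a\<close>
  together with the neighbours \<open>c\<close> of \<open>a\<close> that are kept. A cut isolates a single \<open>b\<close> because the tails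
  are singletons. For a subset of one matching, put on the far side its ends \<open>c\<close> and all vertices \<open>a\<close>
  that it does not touch: untouched hyperedges are always cut, and a touched one is cut iff its bit
  is 1, as the matching is induced. So every cut is a known number plus the number of ones queried.
  It has size at most \<open>2 * N\<close>, and the errors of the \<open>N\<^sup>2\<close> cuts that make up a query add up to at
  most \<open>2 * N ^ 3 * \<epsilon>\<close>.
\<close>

section \<open>Large sets without three-term progressions\<close>

definition progression_free :: "nat set \<Rightarrow> bool" where
  "progression_free X \<longleftrightarrow> (\<forall>x\<in>X. \<forall>y\<in>X. \<forall>z\<in>X. x + y = 2 * z \<longrightarrow> x = y)"

lemma digit_sum_less:
  fixes u :: "nat \<Rightarrow> nat"
  assumes "\<And>i. i < k \<Longrightarrow> u i < q"
  shows "(\<Sum>i<k. u i * q ^ i) < q ^ k"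
  using assms
proof (induction k)
  case (Suc k)
  have "(\<Sum>i<k. u i * q ^ i) < q ^ k" using Suc by simp
  moreover have "(u k + 1) * q ^ k \<le> q * q ^ k"
    using Suc.prems[of k] by (intro mult_right_mono) auto
  ultimately show ?case by simp
qed simp

lemma digits_unique:
  fixes u v :: "nat \<Rightarrow> nat"
  assumes "\<And>i. i < k \<Longrightarrow> u i < q" "\<And>i. i < k \<Longrightarrow> v i < q"
    and "(\<Sum>i<k. u i * q ^ i) = (\<Sum>i<k. v i * q ^ i)" and "i < k"
  shows "u i = v i"
  using assms
proof (induction k)
  case (Suc k)
  let ?a = "\<Sum>i<k. u i * q ^ i" and ?b = "\<Sum>i<k. v i * q ^ i"
  have ab: "?a < q ^ k" "?b < q ^ k" using Suc.prems by (auto intro: digit_sum_less)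
  have eq: "?a + u k * q ^ k = ?b + v k * q ^ k" using Suc.prems(3) by simp
  have "(a + c * q ^ k) div q ^ k = c" if "a < q ^ k" for a c
  proof -
    have "q ^ k \<noteq> 0" using that by linarith
    then show ?thesis using that by (subst div_mult_self1) (assumption, simp)
  qed
  with eq ab have k: "u k = v k" by metis
  with eq have "?a = ?b" by simp
  with Suc k show ?case by (cases "i = k") auto
qed simp

text \<open>Strict convexity of the sphere: for a midpoint \<open>h\<close>, (f - g)^2 = 2 f^2 + 2
  g^2 - 4 h^2 in each coordinate, so equal norms make the distance of \<open>f\<close> and
  \<open>g\<close> vanish.\<close>

lemma parallelogram_eq:
  fixes f g h :: "nat \<Rightarrow> nat"
  assumes "finite I" and mid: "\<And>i. i \<in> I \<Longrightarrow> f i + g i = 2 * h i"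
    and "(\<Sum>i\<in>I. (f i)\<^sup>2) = r" "(\<Sum>i\<in>I. (g i)\<^sup>2) = r" "(\<Sum>i\<in>I. (h i)\<^sup>2) = r"
    and "i \<in> I"
  shows "f i = g i"
proof -
  have "(int (f i) - int (g i))\<^sup>2 = 2 * int ((f i)\<^sup>2) + 2 * int ((g i)\<^sup>2) - 4 * int ((h i)\<^sup>2)"
    if "i \<in> I" for i
  proof -
    have "int (f i) + int (g i) = 2 * int (h i)" using mid[OF that] by linarith
    then have "(int (f i) + int (g i))\<^sup>2 = (2 * int (h i))\<^sup>2" by simp
    then show ?thesis by (simp add: power2_eq_square algebra_simps)
  qed
  then have "(\<Sum>i\<in>I. (int (f i) - int (g i))\<^sup>2)
      = (\<Sum>i\<in>I. 2 * int ((f i)\<^sup>2) + 2 * int ((g i)\<^sup>2) - 4 * int ((h i)\<^sup>2))"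
    by (rule sum.cong[OF refl])
  also have "\<dots> = 2 * int r + 2 * int r - 4 * int r"
    using assms(3-5)[THEN arg_cong[where f = int]]
    by (simp add: sum.distrib sum_subtractf flip: sum_distrib_left)
  finally have "(\<Sum>i\<in>I. (int (f i) - int (g i))\<^sup>2) = 0" by simp
  with assms(1,6) show ?thesis by (simp add: sum_nonneg_eq_0_iff)
qed

text \<open>Lattice points of a cube on a common sphere are read as digit vectors. Digits below
  \<open>m\<close> in base \<open>2 * m\<close> add without carries, so a progression of numbers is
  one of points, and a sphere contains only trivial ones.\<close>

lemma behrend_box:
  "\<exists>X \<subseteq> {..<2 ^ (k * (k + 1))}. progression_free X \<and> 2 ^ (k * k) \<le> card X * 2 ^ (3 * k)"
proof -
  define m :: nat where "m = 2 ^ k"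
  define P where "P = PiE {..<k} (\<lambda>_. {..<m})"
  define norm2 :: "(nat \<Rightarrow> nat) \<Rightarrow> nat" where "norm2 f = (\<Sum>i<k. (f i)\<^sup>2)" for f
  define val :: "(nat \<Rightarrow> nat) \<Rightarrow> nat" where "val f = (\<Sum>i<k. f i * (2 * m) ^ i)" for f
  have finP: "finite P" and cardP: "card P = 2 ^ (k * k)"
    by (simp_all add: P_def finite_PiE card_PiE m_def power_mult)
  have digit: "f i < m" if "f \<in> P" "i < k" for f i using that by (auto simp: P_def)
  have norm2_less: "norm2 f \<in> {..<2 ^ (3 * k)}" if "f \<in> P" for f
  proof -
    have "norm2 f \<le> (\<Sum>i<k. m\<^sup>2)"
      unfolding norm2_def using digit[OF that] by (intro sum_mono power_mono) (auto intro: less_imp_le)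
    also have "\<dots> = k * m\<^sup>2" by simp
    \<comment> \<open>The crude bound k < 2^k leaves at most 2^(3k) spheres.\<close>
    also have "\<dots> < 2 ^ k * m\<^sup>2" by (intro mult_strict_right_mono) (auto simp: m_def)
    also have "\<dots> = 2 ^ (3 * k)" by (simp add: m_def flip: power_mult power_add)
    finally show ?thesis by simp
  qed
  \<comment> \<open>Pigeonhole: some sphere contains many of the lattice points.\<close>
  obtain r where r: "card P \<le> card {f \<in> P. norm2 f = r} * 2 ^ (3 * k)"
  proof (rule ccontr)
    assume "\<not> thesis"
    then have less: "card {f \<in> P. norm2 f = r} * 2 ^ (3 * k) < card P" for r
      using that by (meson not_le)
    have "card P = (\<Sum>r<2 ^ (3 * k). card {f \<in> P. norm2 f = r})"
    proof -
      have "P = (\<Union>r<2 ^ (3 * k). {f \<in> P. norm2 f = r})" using norm2_less by auto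
      then have "card P = card (\<Union>r<2 ^ (3 * k). {f \<in> P. norm2 f = r})" by simp
      also have "\<dots> = (\<Sum>r<2 ^ (3 * k). card {f \<in> P. norm2 f = r})"
        using finP by (intro card_UN_disjoint) auto
      finally show ?thesis .
    qed
    then have "card P * 2 ^ (3 * k) = (\<Sum>r<2 ^ (3 * k). card {f \<in> P. norm2 f = r} * 2 ^ (3 * k))"
      by (simp add: sum_distrib_right)
    also have "\<dots> < (\<Sum>r<(2::nat) ^ (3 * k). card P)"
      using less by (intro sum_strict_mono) (auto simp: lessThan_empty_iff)
    finally show False by simp
  qed
  define F where "F = {f \<in> P. norm2 f = r}"
  have F: "f \<in> P" "norm2 f = r" if "f \<in> F" for f using that by (auto simp: F_def)
  have mid: "f i = g i" if "f \<in> F" "g \<in> F" "h \<in> F" "val f + val g = 2 * val h" "i < k" for f g h i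
  proof -
    have "f j + g j = 2 * h j" if "j < k" for j
    proof (rule digits_unique[where k = k and q = "2 * m"
          and u = "\<lambda>j. f j + g j" and v = "\<lambda>j. 2 * h j"])
      show "(\<Sum>i<k. (f i + g i) * (2 * m) ^ i) = (\<Sum>i<k. 2 * h i * (2 * m) ^ i)"
        using \<open>val f + val g = 2 * val h\<close>
        by (simp add: val_def add_mult_distrib sum.distrib sum_distrib_left mult.assoc)
      show "f i + g i < 2 * m" "2 * h i < 2 * m" if "i < k" for i
        using digit[OF F(1)[OF \<open>f \<in> F\<close>] that] digit[OF F(1)[OF \<open>g \<in> F\<close>] that]
          digit[OF F(1)[OF \<open>h \<in> F\<close>] that] by linarith+
    qed (rule that)
    then show ?thesis
      using F(2)[OF that(1)] F(2)[OF that(2)] F(2)[OF that(3)] \<open>i < k\<close>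
      by - (rule parallelogram_eq[where I = "{..<k}" and h = h and r = r], auto simp: norm2_def)
  qed
  have ext: "f = g" if "f \<in> F" "g \<in> F" "\<And>i. i < k \<Longrightarrow> f i = g i" for f g
    using that by (intro PiE_ext[of f "{..<k}" "\<lambda>_. {..<m}"]) (auto simp: F_def P_def)
  \<comment> \<open>Equal values form the degenerate progression with \<open>h = g\<close>.\<close>
  have inj: "inj_on val F"
    by (intro inj_onI ext) (use mid in auto)
  show ?thesis
  proof (intro exI[of _ "val ` F"] conjI)
    have "val f < 2 ^ (k * (k + 1))" if "f \<in> F" for f
    proof -
      have "val f < (2 * m) ^ k" unfolding val_def
        using digit[OF F(1)[OF that]] by (intro digit_sum_less) fastforce
      also have "\<dots> = 2 ^ (k * (k + 1))" by (simp add: m_def power_add power_mult power_mult_distrib)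
      finally show ?thesis .
    qed
    then show "val ` F \<subseteq> {..<2 ^ (k * (k + 1))}" by auto
    show "progression_free (val ` F)"
      unfolding progression_free_def
    proof safe
      fix f g h assume "f \<in> F" "g \<in> F" "h \<in> F" "val f + val g = 2 * val h"
      then show "val f = val g" unfolding val_def
        using mid by (intro sum.cong refl) (simp add: val_def)
    qed
    show "2 ^ (k * k) \<le> card (val ` F) * 2 ^ (3 * k)"
      using r unfolding cardP card_image[OF inj] by (simp add: F_def)
  qed
qed

text \<open>The largest box that fits below \<open>N\<close> is used; its maximality bounds
  \<open>N\<close> by the next box.\<close>

theorem behrend:
  assumes "N \<ge> 1"
  shows "\<exists>X \<subseteq> {..<N}. progression_free X \<and>
    real N \<le> real (card X) * 2 powr (6 * sqrt (log 2 (real N)) + 2)"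
proof -
  define k where "k = Greatest (\<lambda>k. 2 ^ (k * (k + 1)) \<le> N)"
  have bound: "\<forall>k. 2 ^ (k * (k + 1)) \<le> N \<longrightarrow> k \<le> N"
  proof safe
    fix k :: nat assume *: "2 ^ (k * (k + 1)) \<le> N"
    have "k < 2 ^ k" by simp
    also have "(2::nat) ^ k \<le> 2 ^ (k * (k + 1))" by (intro power_increasing) auto
    finally show "k \<le> N" using * by simp
  qed
  have k: "2 ^ (k * (k + 1)) \<le> N"
    unfolding k_def by (rule GreatestI_nat[where k = 0, OF _ bound[rule_format]]) (use assms in auto)
  have k': "N < 2 ^ ((k + 1) * (k + 2))"
  proof (rule ccontr)
    assume "\<not> ?thesis"
    then have "Suc k \<le> k"
      unfolding k_def by (intro Greatest_le_nat[OF _ bound[rule_format]]) (auto simp: k_def)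
    then show False by simp
  qed
  obtain X where X: "X \<subseteq> {..<2 ^ (k * (k + 1))}" "progression_free X"
    "2 ^ (k * k) \<le> card X * 2 ^ (3 * k)" using behrend_box by blast
  \<comment> \<open>The next box costs a factor 2^(3k + 2) and the pigeonhole 2^(3k): hence the 6
    and the 2 in the exponent.\<close>
  have "(2::nat) ^ ((k + 1) * (k + 2)) = 2 ^ (k * k) * 2 ^ (3 * k + 2)"
    by (simp add: algebra_simps flip: power_add)
  also have "\<dots> \<le> card X * 2 ^ (3 * k) * 2 ^ (3 * k + 2)"
    using X(3) by (rule mult_right_mono) simp
  also have "\<dots> = card X * 2 ^ (6 * k + 2)" by (simp add: mult.assoc flip: power_add)
  finally have "N \<le> card X * 2 ^ (6 * k + 2)" using k' by linarith
  then have "real N \<le> real (card X * 2 ^ (6 * k + 2))" by (simp only: of_nat_le_iff)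
  then have "real N \<le> real (card X) * 2 ^ (6 * k + 2)" by simp
  also have "\<dots> = real (card X) * 2 powr (6 * real k + 2)"
    using powr_realpow[of 2 "6 * k + 2"] by (simp add: add.commute)
  also have "\<dots> \<le> real (card X) * 2 powr (6 * sqrt (log 2 (real N)) + 2)"
  proof -
    have "(2::real) ^ (k * k) \<le> 2 ^ (k * (k + 1))" by (intro power_increasing) auto
    also have "\<dots> \<le> real N" using of_nat_mono[OF k, where 'a = real] by simp
    finally have "real (k * k) \<le> log 2 (real N)" using assms by (intro le_log_of_power) auto
    then have "real k \<le> sqrt (log 2 (real N))" by (intro real_le_rsqrt) (simp add: power2_eq_square)
    then show ?thesis by (intro mult_left_mono powr_mono) auto
  qed
  finally show ?thesis using X k by (intro exI[of _ X]) auto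
qed


section \<open>From bounded sketches to codewords of fixed length\<close>

text \<open>
  Padding sketches of length at most \<open>k\<close> to exactly \<open>k\<close> bits would cost an extra bit. Instead keep
  either the strings with a sketch of exactly \<open>k\<close> bits or those with a shorter sketch, whichever are
  more; the latter sketches are delimited by a marker bit.
\<close>

lemma string_compression_schemeI:
  fixes E :: "bool list \<Rightarrow> bool list"
  assumes "l > 0" "k > 0" "\<epsilon> > 0" "0 < g" "g \<le> 1 / 2"
    and len: "\<And>s. s \<in> bitstrings l \<Longrightarrow> length (E s) \<le> k"
    and dec: "\<And>s q. s \<in> bitstrings l \<Longrightarrow> q \<subseteq> {..<l} \<Longrightarrow>
      \<bar>real (D (E s) q) - real (card (ones s \<inter> q))\<bar> \<le> \<epsilon> * real l / 2"
  shows "\<exists>Encode Decode. string_compression_scheme l k \<epsilon> g Encode Decode"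
proof -
  define F where "F = {s \<in> bitstrings l. length (E s) = k}"
  define T where "T = {s \<in> bitstrings l. length (E s) < k}"
  have bits: "finite (bitstrings l)" "card (bitstrings l) = 2 ^ l"
    using card_lists_length_eq[of "UNIV :: bool set" l] finite_lists_length_eq[of "UNIV :: bool set" l]
    by (simp_all add: bitstrings_def)
  have "F \<union> T = bitstrings l" "F \<inter> T = {}" using len by (force simp: F_def T_def)+
  then have sum: "card F + card T = 2 ^ l"
    using bits card_Un_disjoint[of F T] by (metis finite_Un)
  have half: "g * 2 ^ l \<le> real (card G)" if "2 ^ l \<le> 2 * card G" for G :: "bool list set"
  proof -
    have "(2::real) ^ l \<le> 2 * real (card G)" using of_nat_mono[OF that, where 'a = real] by simp
    moreover have "g * 2 ^ l \<le> 1 / 2 * 2 ^ l" using assms by (intro mult_right_mono) auto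
    ultimately show ?thesis by linarith
  qed
  consider "2 ^ l \<le> 2 * card F" | "2 ^ l \<le> 2 * card T" using sum by linarith
  then show ?thesis
  proof cases
    case 1
    \<comment> \<open>Strings outside the good set only need some codeword of length
      \<open>k\<close>.\<close>
    define Enc where "Enc s = (if s \<in> F then E s else replicate k False)" for s
    have "string_compression_scheme l k \<epsilon> g Enc D"
      unfolding string_compression_scheme_def
      using assms half[OF 1] dec
      by (auto intro!: exI[of _ F] simp: Enc_def F_def bitstrings_def[of k])
    then show ?thesis by blast
  next
    case 2
    define Enc where
      "Enc s = (if s \<in> T then replicate (k - length (E s) - 1) False @ True # E s else replicate k False)" for s
    define Dec where "Dec x = D (tl (dropWhile Not x))" for x
    have "Dec (Enc s) = D (E s)" if "s \<in> T" for s
      using that by (simp add: Enc_def Dec_def dropWhile_append)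
    then have "string_compression_scheme l k \<epsilon> g Enc Dec"
      unfolding string_compression_scheme_def
      using assms half[OF 2] dec
      by (auto intro!: exI[of _ T] simp: T_def bitstrings_def[of k]) (auto simp: Enc_def T_def)
    then show ?thesis by blast
  qed
qed

text \<open>Serves the degenerate \<open>n\<close> with \<open>l n = 1\<close>: the fraction
  \<open>1 / 2 ^ n\<close> of the strings of length \<open>n\<close> is a single string, here the
  zero string.\<close>

lemma singleton_compression_scheme:
  assumes "l > 0" "k > 0" "\<epsilon> > 0"
  shows "string_compression_scheme l k \<epsilon> (1 / 2 ^ l) (\<lambda>_. replicate k False) (\<lambda>_ _. 0)"
proof -
  have "ones (replicate l False) = {}" by (auto simp: ones_def)
  then show ?thesis
    using assms unfolding string_compression_scheme_def
    by (auto intro!: exI[of _ "{replicate l False}"] simp: bitstrings_def)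
qed

section \<open>The hypergraph of a string and its cuts\<close>

text \<open>
  A triple \<open>(b, i, d)\<close> stands for a position of the string. For each \<open>b\<close>, the pair \<open>(i, d)\<close> is the edge
  of a Ruzsa--Szemeredi graph joining \<open>a = i + d\<close> and \<open>c = i + 2 d\<close>, and \<open>i\<close> names the induced matching
  that contains it. The vertex set \<open>{..<6 * N}\<close> is laid out as \<open>a < 2 * N\<close>, then
  \<open>2 * N + c\<close> with \<open>c < 3 * N\<close>, then \<open>5 * N + b\<close> with \<open>b < N\<close>.
\<close>

definition rs_head :: "nat \<Rightarrow> (nat \<times> nat \<times> nat) set \<Rightarrow> nat \<Rightarrow> nat \<Rightarrow> nat set" where
  "rs_head N W b a = insert a {2 * N + i + 2 * d | i d. (b, i, d) \<in> W \<and> a = i + d}"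

definition rs_hypergraph :: "nat \<Rightarrow> (nat \<times> nat \<times> nat) set \<Rightarrow> nat hyperedge set" where
  "rs_hypergraph N W = (\<lambda>(b, a). ({5 * N + b}, rs_head N W b a)) ` ({..<N} \<times> {..<2 * N})"

text \<open>What is subtracted is the far side of the cut. It contains every tail except that of
  \<open>b\<close>, so only copy \<open>b\<close> is seen.\<close>

definition rs_query :: "nat \<Rightarrow> nat \<Rightarrow> nat \<Rightarrow> nat \<Rightarrow> nat set \<Rightarrow> nat set" where
  "rs_query n N b i D = {..<n} -
     (({..<2 * N} - (+) i ` D) \<union> (\<lambda>d. 2 * N + i + 2 * d) ` D \<union> ({5 * N..<6 * N} - {5 * N + b}))"

text \<open>The first summand counts the vertices \<open>a\<close> that \<open>D\<close> does not
  touch: each lies in its own head and on the far side. The second counts the kept edges of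
  \<open>D\<close>.\<close>

lemma cut_rs_hypergraph:
  assumes X: "X \<subseteq> {..<N}" "progression_free X" and W: "W \<subseteq> {..<N} \<times> {..<N} \<times> X"
    and "6 * N \<le> n" "b < N" "i < N" "D \<subseteq> X"
  shows "cut {..<n} (rs_hypergraph N W) (rs_query n N b i D)
    = (2 * N - card D) + card {d \<in> D. (b, i, d) \<in> W}"
proof -
  let ?S = "rs_query n N b i D"
  let ?e = "\<lambda>b a. ({5 * N + b}, rs_head N W b a)"
  define A where "A = ({..<2 * N} - (+) i ` D) \<union> (+) i ` {d \<in> D. (b, i, d) \<in> W}"
  have D: "d < N" if "d \<in> D" for d using that assms by auto
  have finD: "finite D" using assms by (meson finite_lessThan finite_subset)
  have tail: "{5 * N + b'} \<inter> ?S \<noteq> {} \<longleftrightarrow> b' = b" if "b' < N" for b'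
    using that assms D by (fastforce simp: rs_query_def)
  have comp: "{..<n} - ?S =
      ({..<2 * N} - (+) i ` D) \<union> (\<lambda>d. 2 * N + i + 2 * d) ` D \<union> ({5 * N..<6 * N} - {5 * N + b})"
    unfolding rs_query_def using assms D by fastforce
  \<comment> \<open>The matching is induced: progression-freeness excludes edges between ends of different members.\<close>
  have head: "rs_head N W b a \<inter> ({..<n} - ?S) \<noteq> {} \<longleftrightarrow> a \<in> A" if "a < 2 * N" for a
  proof
    assume "rs_head N W b a \<inter> ({..<n} - ?S) \<noteq> {}"
    then obtain v where v: "v \<in> rs_head N W b a" "v \<in> {..<n} - ?S" by blast
    show "a \<in> A"
    proof (cases "v = a")
      case True
      with v that show ?thesis unfolding comp A_def by auto
    next
      case False
      then obtain j e where je: "(b, j, e) \<in> W" "a = j + e" "v = 2 * N + j + 2 * e"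
        using v by (auto simp: rs_head_def)
      have e: "j < N" "e \<in> X" "e < N" using je W X by auto
      \<comment> \<open>The layers are disjoint, so \<open>v\<close> can only be an end of an edge
        of \<open>D\<close>.\<close>
      then have "v < 5 * N" "v \<ge> 2 * N" using je by auto
      then obtain d where d: "d \<in> D" "v = 2 * N + i + 2 * d" using v unfolding comp by auto
      show ?thesis
      proof (cases "a \<in> (+) i ` D")
        case False
        then show ?thesis using that by (simp add: A_def)
      next
        case True
        then obtain d' where d': "d' \<in> D" "a = i + d'" by auto
        \<comment> \<open>From i + d' = j + e and i + 2 d = j + 2 e.\<close>
        have "d' + e = 2 * d" using d d' je by linarith
        then have "d' = e" using X(2) d d' e assms unfolding progression_free_def by blast
        then show ?thesis using d' je by (auto simp: A_def)
      qed
    qed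
  next
    assume "a \<in> A"
    then consider "a \<notin> (+) i ` D" | d where "d \<in> D" "(b, i, d) \<in> W" "a = i + d"
      by (auto simp: A_def)
    then show "rs_head N W b a \<inter> ({..<n} - ?S) \<noteq> {}"
    proof cases
      case 1
      then have "a \<in> rs_head N W b a \<inter> ({..<n} - ?S)"
        using that unfolding comp by (simp add: rs_head_def)
      then show ?thesis by blast
    next
      case 2
      then have "2 * N + i + 2 * d \<in> rs_head N W b a \<inter> ({..<n} - ?S)"
        unfolding comp by (auto simp: rs_head_def)
      then show ?thesis by blast
    qed
  qed
  have A: "A \<subseteq> {..<2 * N}" using D \<open>i < N\<close> by (fastforce simp: A_def)
  have "{(L, R) \<in> rs_hypergraph N W. L \<inter> ?S \<noteq> {} \<and> R \<inter> ({..<n} - ?S) \<noteq> {}} = ?e b ` A"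
  proof (intro equalityI subsetI; clarify)
    fix L R assume "(L, R) \<in> rs_hypergraph N W"
      and *: "L \<inter> ?S \<noteq> {}" "R \<inter> ({..<n} - ?S) \<noteq> {}"
    then obtain b' a where e: "b' < N" "a < 2 * N" "L = {5 * N + b'}" "R = rs_head N W b' a"
      by (auto simp: rs_hypergraph_def)
    then have "b' = b" using * tail[of b'] by blast
    then show "(L, R) \<in> ?e b ` A" using * e head[of a] by blast
  next
    fix a assume a: "a \<in> A"
    then have "a < 2 * N" using A by auto
    then have "?e b a \<in> rs_hypergraph N W"
      using \<open>b < N\<close> by (auto simp: rs_hypergraph_def)
    then show "?e b a \<in> rs_hypergraph N W \<and> {5 * N + b} \<inter> ?S \<noteq> {}
        \<and> rs_head N W b a \<inter> ({..<n} - ?S) \<noteq> {}"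
      using tail[OF \<open>b < N\<close>] head[OF \<open>a < 2 * N\<close>] a by blast
  qed
  \<comment> \<open>Hyperedges form a set, so they must be distinct to be counted; \<open>a\<close>
    is recovered as the only small vertex of its head.\<close>
  moreover have "inj_on (?e b) A"
  proof (rule inj_onI)
    fix a a' assume a: "a \<in> A" "a' \<in> A" and "?e b a = ?e b a'"
    then have "rs_head N W b a \<inter> {..<2 * N} = rs_head N W b a' \<inter> {..<2 * N}" by simp
    moreover have "rs_head N W b x \<inter> {..<2 * N} = {x}" if "x \<in> A" for x
      using that A by (auto simp: rs_head_def)
    ultimately show "a = a'" using a by auto
  qed
  ultimately have "cut {..<n} (rs_hypergraph N W) ?S = card A"
    by (simp add: cut_def card_image)
  also have "\<dots> = card ({..<2 * N} - (+) i ` D) + card ((+) i ` {d \<in> D. (b, i, d) \<in> W})"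
    unfolding A_def using finD by (intro card_Un_disjoint) auto
  also have "card ({..<2 * N} - (+) i ` D) = 2 * N - card D"
    using finD D \<open>i < N\<close> by (subst card_Diff_subset) (fastforce simp: card_image)+
  finally show ?thesis by (simp add: card_image)
qed

lemma directed_rs_hypergraph:
  assumes "X \<subseteq> {..<N}" "W \<subseteq> {..<N} \<times> {..<N} \<times> X" "6 * N \<le> n"
  shows "directed_hypergraph {..<n} (rs_hypergraph N W)"
proof -
  have "2 * N + i + 2 * d < n" if "(b, i, d) \<in> W" for b i d using that assms by fastforce
  then show ?thesis using assms(3)
    by (auto simp: directed_hypergraph_def rs_hypergraph_def rs_head_def)
qed

lemma card_triples:
  fixes Z :: "(nat \<times> nat \<times> nat) set"
  assumes "Z \<subseteq> {..<N} \<times> {..<N} \<times> X" "finite X"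
  shows "card Z = (\<Sum>b<N. \<Sum>i<N. card {d \<in> X. (b, i, d) \<in> Z})"
proof -
  have "Z = (SIGMA b:{..<N}. SIGMA i:{..<N}. {d \<in> X. (b, i, d) \<in> Z})" using assms by auto
  then have "card Z = card (SIGMA b:{..<N}. SIGMA i:{..<N}. {d \<in> X. (b, i, d) \<in> Z})" by simp
  also have "\<dots> = (\<Sum>b<N. \<Sum>i<N. card {d \<in> X. (b, i, d) \<in> Z})"
    using assms by (simp add: card_SigmaI)
  finally show ?thesis .
qed

section \<open>String compression from cut sketches\<close>

lemma compression_scheme_of_sketching_scheme:
  assumes X: "X \<subseteq> {..<N}" "progression_free X"
    and size: "6 * N \<le> n" "n * l \<le> N * (N * card X)" and pos: "n > 0" "l > 0" "k > 0"
    and eps: "0 \<le> \<epsilon>" "40 * real n ^ 2 * \<epsilon> \<le> real l"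
    and scheme: "cut_sketching_scheme {..<n} \<epsilon> k sketch estimate"
  shows "\<exists>Encode Decode. string_compression_scheme (n * l) k (1 / 10) (1 / 2 ^ n) Encode Decode"
proof -
  have finX: "finite X" using X(1) finite_subset by blast
  \<comment> \<open>Half of the allowed error n l / 20: one half is for the estimates, the other for
    \<open>D\<close>.\<close>
  define err where "err = real (n * l) / 40"
  have "\<exists>\<phi>. \<phi> ` {..<n * l} \<subseteq> {..<N} \<times> {..<N} \<times> X \<and> inj_on \<phi> {..<n * l}"
    using size finX by (intro card_le_inj) (auto simp: card_cartesian_product)
  then obtain \<phi> where \<phi>: "\<phi> ` {..<n * l} \<subseteq> {..<N} \<times> {..<N} \<times> X" "inj_on \<phi> {..<n * l}"
    by blast
  \<comment> \<open>The part of the query in matching \<open>i\<close> of copy \<open>b\<close>,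
    answered by one cut.\<close>
  define slice where "slice q b i = {d \<in> X. (b, i, d) \<in> \<phi> ` q}" for q b i
  define E where "E s = sketch (rs_hypergraph N (\<phi> ` ones s))" for s
  define approx :: "bool list \<Rightarrow> nat set \<Rightarrow> real" where
    "approx x q = (\<Sum>b<N. \<Sum>i<N.
       estimate x (rs_query n N b i (slice q b i)) - (2 * real N - real (card (slice q b i))))" for x q
  \<comment> \<open>The true count shows that such a natural number exists; picking any one avoids a
    separate rounding error.\<close>
  define D where "D x q = (SOME v :: nat. \<bar>approx x q - real v\<bar> \<le> err)" for x q
  have sub: "\<phi> ` q \<subseteq> {..<N} \<times> {..<N} \<times> X" if "q \<subseteq> {..<n * l}" for q using \<phi>(1) that by blast
  have ones: "ones s \<subseteq> {..<n * l}" if "s \<in> bitstrings (n * l)" for s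
    using that by (auto simp: ones_def bitstrings_def)
  have close: "\<bar>approx (E s) q - real (card (ones s \<inter> q))\<bar> \<le> err"
    if s: "s \<in> bitstrings (n * l)" and q: "q \<subseteq> {..<n * l}" for s q
  proof -
    define W where "W = \<phi> ` ones s"
    define hit where "hit b i = {d \<in> slice q b i. (b, i, d) \<in> W}" for b i
    have W: "W \<subseteq> {..<N} \<times> {..<N} \<times> X" unfolding W_def by (rule sub[OF ones[OF s]])
    have each: "\<bar>estimate (E s) (rs_query n N b i (slice q b i))
        - (2 * real N - real (card (slice q b i))) - real (card (hit b i))\<bar> \<le> \<epsilon> * (2 * real N)"
      if "b < N" "i < N" for b i
    proof -
      let ?S = "rs_query n N b i (slice q b i)"
      let ?c = "cut {..<n} (rs_hypergraph N W) ?S"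
      have sl: "slice q b i \<subseteq> X" by (auto simp: slice_def)
      have c: "?c = (2 * N - card (slice q b i)) + card (hit b i)"
        unfolding hit_def using X W size(1) that sl by (rule cut_rs_hypergraph)
      have "card (slice q b i) \<le> card X" using sl finX by (rule card_mono[rotated])
      moreover have "card X \<le> N" using card_mono[OF _ X(1)] by simp
      moreover have "card (hit b i) \<le> card (slice q b i)"
        using finite_subset[OF sl finX] by (intro card_mono) (auto simp: hit_def)
      ultimately have c': "real ?c = 2 * real N - real (card (slice q b i)) + real (card (hit b i))"
        and "real ?c \<le> 2 * real N"
        unfolding c by auto
      then have "\<epsilon> * real ?c \<le> \<epsilon> * (2 * real N)" using eps(1) by (intro mult_left_mono)
      moreover have "?S \<subseteq> {..<n}" by (auto simp: rs_query_def)
      then have "(1 - \<epsilon>) * real ?c \<le> estimate (E s) ?S" "estimate (E s) ?S \<le> (1 + \<epsilon>) * real ?c"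
        using scheme directed_rs_hypergraph[OF X(1) W size(1)]
        by (auto simp: cut_sketching_scheme_def E_def W_def)
      ultimately show ?thesis using c' by (simp add: algebra_simps abs_le_iff)
    qed
    have "card (ones s \<inter> q) = card (\<phi> ` (ones s \<inter> q))"
      using \<phi>(2) q by (intro card_image[symmetric] inj_on_subset[OF \<phi>(2)]) auto
    also have "\<phi> ` (ones s \<inter> q) = W \<inter> \<phi> ` q"
      unfolding W_def by (rule inj_on_image_Int[OF \<phi>(2) ones[OF s] q])
    also have "card (W \<inter> \<phi> ` q) = (\<Sum>b<N. \<Sum>i<N. card {d \<in> X. (b, i, d) \<in> W \<inter> \<phi> ` q})"
      using W finX by (intro card_triples) auto
    also have "\<dots> = (\<Sum>b<N. \<Sum>i<N. card (hit b i))"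
      by (simp add: hit_def slice_def conj_ac)
    finally have "\<bar>approx (E s) q - real (card (ones s \<inter> q))\<bar>
        = \<bar>\<Sum>b<N. \<Sum>i<N. estimate (E s) (rs_query n N b i (slice q b i))
            - (2 * real N - real (card (slice q b i))) - real (card (hit b i))\<bar>"
      by (simp add: approx_def sum_subtractf)
    also have "\<dots> \<le> (\<Sum>b<N. \<Sum>i<N. \<epsilon> * (2 * real N))"
      by (intro order.trans[OF sum_abs] sum_mono each) auto
    also have "\<dots> = \<epsilon> * (2 * real N ^ 3)" by (simp add: power3_eq_cube)
    also have "\<dots> \<le> \<epsilon> * real n ^ 3"
    proof (intro mult_left_mono eps(1))
      have "(2 * real N) ^ 3 \<le> real n ^ 3" using size(1) by (intro power_mono) auto
      moreover have "2 * real N ^ 3 \<le> (2 * real N) ^ 3" by (simp add: power_mult_distrib)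
      ultimately show "2 * real N ^ 3 \<le> real n ^ 3" by linarith
    qed
    also have "\<dots> \<le> err"
      using mult_left_mono[OF eps(2), of "real n"] by (simp add: err_def power2_eq_square power3_eq_cube mult_ac)
    finally show ?thesis .
  qed
  show ?thesis
  proof (rule string_compression_schemeI[where E = E and D = D])
    show "(1::real) / 2 ^ n \<le> 1 / 2"
      using power_increasing[of 1 n "2::real"] pos by (simp add: field_simps)
    fix s assume s: "s \<in> bitstrings (n * l)"
    show "length (E s) \<le> k"
      using scheme directed_rs_hypergraph[OF X(1) sub[OF ones[OF s]] size(1)]
      by (auto simp: cut_sketching_scheme_def E_def)
    fix q assume q: "q \<subseteq> {..<n * l}"
    have "\<bar>approx (E s) q - real (D (E s) q)\<bar> \<le> err"
      unfolding D_def by (rule someI[where P = "\<lambda>v. \<bar>approx (E s) q - real v\<bar> \<le> err"]) (rule close[OF s q])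
    with close[OF s q] show "\<bar>real (D (E s) q) - real (card (ones s \<inter> q))\<bar> \<le> 1 / 10 * real (n * l) / 2"
      unfolding err_def by linarith
  qed (use pos in auto)
qed

section \<open>Choice of the parameters\<close>

theorem theorem4p5:
  "\<exists>(\<alpha> :: nat \<Rightarrow> real) (\<beta> :: nat \<Rightarrow> real) (l :: nat \<Rightarrow> nat).
     \<alpha> \<in> O(\<lambda>n. sqrt (log 2 (real n))) \<and>
     \<beta> \<in> O(\<lambda>n. sqrt (log 2 (real n))) \<and>
     (\<forall>n. 0 \<le> \<alpha> n \<and> 0 \<le> \<beta> n) \<and>
     (\<forall>n \<ge> 1.
        real (l n) = real n ^ 2 / 2 powr \<beta> n \<and>
        (\<forall>(k :: nat) sketch estimate.
           k \<ge> 1 \<longrightarrow>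
           cut_sketching_scheme {..<n} (1 / 2 powr \<alpha> n) k sketch estimate \<longrightarrow>
           (\<exists>Encode Decode.
              string_compression_scheme (n * l n) k (1 / 10) (1 / 2 ^ n) Encode Decode)))"
proof -
  obtain X where X: "\<And>N. N \<ge> 1 \<Longrightarrow> X N \<subseteq> {..<N} \<and> progression_free (X N) \<and>
      real N \<le> real (card (X N)) * 2 powr (6 * sqrt (log 2 (real N)) + 2)"
    using behrend by metis
  \<comment> \<open>The three layers occupy \<open>6 * N\<close> vertices.\<close>
  define N :: "nat \<Rightarrow> nat" where "N n = n div 6" for n
  define l0 where "l0 n = (N n)\<^sup>2 * card (X (N n)) div n" for n
  \<comment> \<open>The maximum keeps the length positive when the construction offers fewer than
    \<open>n\<close> positions.\<close>
  define l where "l n = max 1 (l0 n)" for n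
  \<comment> \<open>Solved from \<open>l n\<close>, so that the required identity is exact despite
    the integer division.\<close>
  define \<beta> where "\<beta> n = (if n = 0 then 0 else log 2 (real n ^ 2 / real (l n)))" for n
  \<comment> \<open>The 6 provides 2^6 = 64 \<ge> 40, as the error bound demands.\<close>
  define \<alpha> where "\<alpha> n = \<beta> n + 6" for n
  have l_pos: "l n \<ge> 1" for n by (simp add: l_def)
  have l_le: "l n \<le> n\<^sup>2" if "n \<ge> 1" for n
  proof -
    have "l0 n \<le> n\<^sup>2"
    proof (cases "N n = 0")
      case False
      then have "card (X (N n)) \<le> N n" using X[of "N n"] card_mono[of "{..<N n}" "X (N n)"] by auto
      then have "(N n)\<^sup>2 * card (X (N n)) \<le> n\<^sup>2 * n"
        by (intro mult_mono power_mono) (auto simp: N_def)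
      then have "l0 n \<le> n\<^sup>2 * n div n" unfolding l0_def by (rule div_le_mono)
      then show ?thesis using that by simp
    qed (simp add: l0_def)
    then show ?thesis using that by (simp add: l_def)
  qed
  have \<beta>_nonneg: "0 \<le> \<beta> n" for n
  proof (cases "n = 0")
    case False
    have "real (l n) \<le> real n ^ 2" using of_nat_mono[OF l_le[of n], where 'a = real] False by simp
    then show ?thesis using False l_pos[of n] by (simp add: \<beta>_def)
  qed (simp add: \<beta>_def)
  have l_eq: "real (l n) = real n ^ 2 / 2 powr \<beta> n" if "n \<ge> 1" for n
    using that l_pos[of n] by (simp add: \<beta>_def)
  have compress: "\<exists>Encode Decode. string_compression_scheme (n * l n) k (1 / 10) (1 / 2 ^ n) Encode Decode"
    if "n \<ge> 1" "k \<ge> 1" and scheme: "cut_sketching_scheme {..<n} (1 / 2 powr \<alpha> n) k sketch estimate"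
    for n k sketch estimate
  proof (cases "l0 n = 0")
    case True
    then have "l n = 1" by (simp add: l_def)
    then show ?thesis using singleton_compression_scheme[of n k "1 / 10"] that by auto
  next
    case False
    then have l: "l n = l0 n" and "N n \<ge> 1"
      by (auto simp: l_def l0_def intro!: Suc_leI gr0I)
    have "40 * real n ^ 2 * (1 / 2 powr \<alpha> n) = 40 / 64 * real (l n)"
      using l_eq[OF that(1)] by (simp add: \<alpha>_def powr_add)
    also have "\<dots> \<le> real (l n)" by simp
    finally have eps: "40 * real n ^ 2 * (1 / 2 powr \<alpha> n) \<le> real (l n)" .
    show ?thesis
    proof (rule compression_scheme_of_sketching_scheme[OF _ _ _ _ _ _ _ _ eps scheme])
      show "n * l n \<le> N n * (N n * card (X (N n)))"
        unfolding l l0_def by (simp add: power2_eq_square mult.assoc)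
    qed (use X[OF \<open>N n \<ge> 1\<close>] that l_pos[of n] in \<open>auto simp: N_def\<close>)
  qed
  \<comment> \<open>n \<le> 12 N costs 12^3 and rounding \<open>l\<close> a factor 2; their product
    3456 is below 2^12, and Behrend's exponent adds 2.\<close>
  have \<beta>_le: "\<beta> n \<le> 14 + 6 * sqrt (log 2 (real n))" if "n \<ge> 6" for n
  proof -
    define t where "t = 6 * sqrt (log 2 (real n)) + 2"
    have N: "N n \<ge> 1" "n \<le> 12 * N n" "N n \<le> n" unfolding N_def using that by presburger+
    have "real (N n) \<le> real (card (X (N n))) * 2 powr (6 * sqrt (log 2 (real (N n))) + 2)"
      using X[OF N(1)] by blast
    also have "\<dots> \<le> real (card (X (N n))) * 2 powr t"
      unfolding t_def using N by (intro mult_left_mono powr_mono add_right_mono real_sqrt_le_mono) auto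
    finally have XN: "real (N n) \<le> real (card (X (N n))) * 2 powr t" .
    have "(N n)\<^sup>2 * card (X (N n)) \<le> n * (2 * l n)"
    proof -
      have "(N n)\<^sup>2 * card (X (N n)) \<le> n * l0 n + n"
        unfolding l0_def using that
        by (metis add_left_mono mod_less_divisor less_imp_le mult_div_mod_eq order_less_le_trans zero_less_numeral)
      also have "\<dots> \<le> n * (2 * l n)" unfolding l_def by (cases "l0 n") auto
      finally show ?thesis .
    qed
    from of_nat_mono[OF this, where 'a = real]
    have size: "real (N n) ^ 2 * real (card (X (N n))) \<le> real n * (2 * real (l n))" by simp
    have "real n ^ 3 \<le> (12 * real (N n)) ^ 3" using N by (intro power_mono) auto
    also have "\<dots> = 1728 * (real (N n) ^ 2 * real (N n))"
      by (simp add: power_mult_distrib power2_eq_square power3_eq_cube)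
    also have "\<dots> \<le> 1728 * (real (N n) ^ 2 * (real (card (X (N n))) * 2 powr t))"
      using XN by (intro mult_left_mono) auto
    also have "\<dots> \<le> 1728 * (real n * (2 * real (l n)) * 2 powr t)"
      using mult_right_mono[OF size, of "2 powr t"] by (simp add: mult_ac)
    finally have "real n * real n ^ 2 \<le> real n * (3456 * real (l n) * 2 powr t)"
      by (simp add: power2_eq_square power3_eq_cube mult_ac)
    then have "real n ^ 2 \<le> 3456 * real (l n) * 2 powr t" using that by simp
    also have "\<dots> \<le> 2 ^ 12 * real (l n) * 2 powr t" by (intro mult_right_mono) auto
    finally have "real n ^ 2 / real (l n) \<le> 2 powr (12 + t)"
      using l_pos[of n] by (simp add: field_simps powr_add)
    then have "log 2 (real n ^ 2 / real (l n)) \<le> 12 + t"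
      using that l_pos[of n] by (simp add: log_le_iff)
    then show ?thesis using that by (simp add: \<beta>_def t_def)
  qed
  \<comment> \<open>Since sqrt (log 2 n) \<ge> 1, constants are absorbed: 26 = 14 + 6 + 6.\<close>
  have large: "\<beta> n \<le> 26 * sqrt (log 2 (real n)) \<and> \<alpha> n \<le> 26 * sqrt (log 2 (real n))" if "n \<ge> 6" for n
  proof -
    have "1 \<le> sqrt (log 2 (real n))" using that by (simp add: le_log_iff)
    then show ?thesis unfolding \<alpha>_def using \<beta>_le[OF that] by linarith
  qed
  have "\<alpha> \<in> O(\<lambda>n. sqrt (log 2 (real n)))"
    by (intro bigoI[where c = 26] eventually_sequentiallyI[of 6]) (use large \<beta>_nonneg in \<open>simp add: \<alpha>_def\<close>)
  moreover have "\<beta> \<in> O(\<lambda>n. sqrt (log 2 (real n)))"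
    by (intro bigoI[where c = 26] eventually_sequentiallyI[of 6]) (use large \<beta>_nonneg in simp)
  ultimately show ?thesis
    using \<beta>_nonneg l_eq compress
    by (intro exI[of _ \<alpha>] exI[of _ \<beta>] exI[of _ l]) (auto simp: \<alpha>_def)
qed

end
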